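(* Let $M$ be a matroid with set of circuits $\mathcal{C}(M)$ and set of cocircuits $\mathcal{C}^*(M)$, and let $K$ be a field of characteristic not equal to $2$. Introduce variables $a_{e,X}$ for each pair $X\in\mathcal{C}(M)$, $e\in X$, and $b_{e,Y}$ for each pair $Y\in\mathcal{C}^*(M)$, $e\in Y$, and consider the system of polynomial equations over $K$: $a_{e,X}^2-1=0$ for every $X\in\mathcal{C}(M)$, $e\in X$; $b_{e,Y}^2-1=0$ for every $Y\in\mathcal{C}^*(M)$, $e\in Y$; $a_{e,X}b_{e,Y}+a_{f,X}b_{f,Y}=0$ for every $X\in\mathcal{C}(M)$, $Y\in\mathcal{C}^*(M)$ with $X\cap Y=\{e,f\}$ (two distinct elements); $a_{e,X}b_{e,Y}a_{f,X}b_{f,Y}+a_{f,X}b_{f,Y}a_{g,X}b_{g,Y}+a_{g,X}b_{g,Y}a_{e,X}b_{e,Y}+1=0$ for every $X\in\mathcal{C}(M)$, $Y\in\mathcal{C}^*(M)$ with $X\cap Y=\{e,f,g\}$ (three distinct elements). Then $M$ is orientable if and only if this system has a solution over $K$.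
   Context: With $\Sigma=\{0,+,-\}$ (multiplied and compared with $0$ as signs), a $\Sigma$-mapping for a matroid $M$ is a pair of maps $\phi_\Sigma:E(M)\times\mathcal{C}(M)\to\Sigma$, $\phi^*_\Sigma:E(M)\times\mathcal{C}^*(M)\to\Sigma$ with $\phi_\Sigma(e,X)=0$ iff $e\notin X$ and $\phi^*_\Sigma(e,Y)=0$ iff $e\notin Y$. The matroid $M$ is orientable if it has a $\Sigma$-mapping such that for every $X\in\mathcal{C}(M)$, $Y\in\mathcal{C}^*(M)$ with $|X\cap Y|\in\{2,3\}$: $\phi_\Sigma(e,X)\phi^*_\Sigma(e,Y)>0$ for some $e\in X\cap Y$ if and only if $\phi_\Sigma(f,X)\phi^*_\Sigma(f,Y)<0$ for some $f\in X\cap Y$. *)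

theory Defs
  imports Main
begin

locale matroid =
  fixes E :: "'e set" and indep :: "'e set \<Rightarrow> bool"
  assumes finite_ground: "finite E"
    and indep_subset_ground: "indep I \<Longrightarrow> I \<subseteq> E"
    and indep_empty: "indep {}"
    and indep_subset: "indep J \<Longrightarrow> I \<subseteq> J \<Longrightarrow> indep I"
    and indep_augment: "indep I \<Longrightarrow> indep J \<Longrightarrow> card I < card J \<Longrightarrow> \<exists>x\<in>J - I. indep (insert x I)"

definition basis :: "('e set \<Rightarrow> bool) \<Rightarrow> 'e set \<Rightarrow> bool" where
  "basis indep B \<longleftrightarrow> indep B \<and> (\<forall>I. indep I \<and> B \<subseteq> I \<longrightarrow> I = B)"

definition dual_indep :: "'e set \<Rightarrow> ('e set \<Rightarrow> bool) \<Rightarrow> 'e set \<Rightarrow> bool" where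
  "dual_indep E indep I \<longleftrightarrow> I \<subseteq> E \<and> (\<exists>B. basis indep B \<and> I \<subseteq> E - B)"

definition circuits :: "'e set \<Rightarrow> ('e set \<Rightarrow> bool) \<Rightarrow> 'e set set" where
  "circuits E indep = {X. X \<subseteq> E \<and> \<not> indep X \<and> (\<forall>Z. Z \<subset> X \<longrightarrow> indep Z)}"

definition cocircuits :: "'e set \<Rightarrow> ('e set \<Rightarrow> bool) \<Rightarrow> 'e set set" where
  "cocircuits E indep = circuits E (dual_indep E indep)"

datatype sign = Neg | Zero | Pos

instantiation sign :: "{zero, times, ord}"
begin

definition zero_sign :: sign where "0 = Zero"

fun times_sign :: "sign \<Rightarrow> sign \<Rightarrow> sign" where
  "Zero * t = Zero"
| "s * Zero = Zero"
| "Pos * Pos = Pos"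
| "Pos * Neg = Neg"
| "Neg * Pos = Neg"
| "Neg * Neg = Pos"

fun less_sign :: "sign \<Rightarrow> sign \<Rightarrow> bool" where
  "Neg < t \<longleftrightarrow> t \<noteq> Neg"
| "Zero < t \<longleftrightarrow> t = Pos"
| "Pos < t \<longleftrightarrow> False"

definition less_eq_sign :: "sign \<Rightarrow> sign \<Rightarrow> bool" where
  "s \<le> t \<longleftrightarrow> s < t \<or> s = t" for s t :: sign

instance ..

end

instance sign :: linorder
proof
  fix r s t :: sign
  show "(s < t) = (s \<le> t \<and> \<not> t \<le> s)" "s \<le> s" "s \<le> t \<or> t \<le> s"
    by (cases s; cases t; simp add: less_eq_sign_def)+
  show "s \<le> t \<Longrightarrow> t \<le> s \<Longrightarrow> s = t"
    by (cases s; cases t; simp add: less_eq_sign_def)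
  show "r \<le> s \<Longrightarrow> s \<le> t \<Longrightarrow> r \<le> t"
    by (cases r; cases s; cases t; simp add: less_eq_sign_def)
qed

text \<open>
  Maps defined on pairs (element, circuit) are total functions here; only their values at
  elements of \<open>E\<close> and at circuits (cocircuits) matter.
\<close>

definition sigma_mapping ::
  "'e set \<Rightarrow> ('e set \<Rightarrow> bool) \<Rightarrow> ('e \<Rightarrow> 'e set \<Rightarrow> sign) \<Rightarrow> ('e \<Rightarrow> 'e set \<Rightarrow> sign) \<Rightarrow> bool" where
  "sigma_mapping E indep \<phi> \<phi>' \<longleftrightarrow>
     (\<forall>e\<in>E. \<forall>X\<in>circuits E indep. \<phi> e X = 0 \<longleftrightarrow> e \<notin> X) \<and>
     (\<forall>e\<in>E. \<forall>Y\<in>cocircuits E indep. \<phi>' e Y = 0 \<longleftrightarrow> e \<notin> Y)"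

definition orientable :: "'e set \<Rightarrow> ('e set \<Rightarrow> bool) \<Rightarrow> bool" where
  "orientable E indep \<longleftrightarrow>
     (\<exists>\<phi> \<phi>'. sigma_mapping E indep \<phi> \<phi>' \<and>
        (\<forall>X\<in>circuits E indep. \<forall>Y\<in>cocircuits E indep. card (X \<inter> Y) \<in> {2, 3} \<longrightarrow>
           ((\<exists>e\<in>X \<inter> Y. \<phi> e X * \<phi>' e Y > 0) \<longleftrightarrow> (\<exists>f\<in>X \<inter> Y. \<phi> f X * \<phi>' f Y < 0))))"

text \<open>
  The variables \<open>a e X\<close>, \<open>b e Y\<close> with \<open>e \<notin> X\<close> or \<open>e \<notin> Y\<close> do not occur in the system.
\<close>

definition solves_orientation_system ::
  "'e set \<Rightarrow> ('e set \<Rightarrow> bool) \<Rightarrow> ('e \<Rightarrow> 'e set \<Rightarrow> 'k::field) \<Rightarrow> ('e \<Rightarrow> 'e set \<Rightarrow> 'k) \<Rightarrow> bool" where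
  "solves_orientation_system E indep a b \<longleftrightarrow>
     (\<forall>X\<in>circuits E indep. \<forall>e\<in>X. (a e X)\<^sup>2 - 1 = 0) \<and>
     (\<forall>Y\<in>cocircuits E indep. \<forall>e\<in>Y. (b e Y)\<^sup>2 - 1 = 0) \<and>
     (\<forall>X\<in>circuits E indep. \<forall>Y\<in>cocircuits E indep. \<forall>e f.
        e \<noteq> f \<and> X \<inter> Y = {e, f} \<longrightarrow> a e X * b e Y + a f X * b f Y = 0) \<and>
     (\<forall>X\<in>circuits E indep. \<forall>Y\<in>cocircuits E indep. \<forall>e f g.
        e \<noteq> f \<and> f \<noteq> g \<and> e \<noteq> g \<and> X \<inter> Y = {e, f, g} \<longrightarrow>
          a e X * b e Y * a f X * b f Y + a f X * b f Y * a g X * b g Y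
            + a g X * b g Y * a e X * b e Y + 1 = 0)"

end

theory Submission
  imports Defs
begin

text \<open>
  A solution of the system takes only the values \<open>1\<close> and \<open>-1\<close>, so it is the same thing as a
  sign mapping. For \<open>p, q, r \<in> {1, -1}\<close> and \<open>2 \<noteq> 0\<close>, the equation \<open>p + q = 0\<close> says that \<open>p\<close>
  and \<open>q\<close> differ, and \<open>p q + q r + r p\<close> is \<open>3\<close> when \<open>p, q, r\<close> all agree and \<open>-1\<close> otherwise, so
  \<open>p q + q r + r p + 1 = 0\<close> says that both signs occur among \<open>p, q, r\<close>.
\<close>

text \<open>Sending \<open>Zero\<close> to 0 makes the map multiplicative on all signs, so products
  need no case distinction.\<close>

fun sign_value :: "sign \<Rightarrow> 'k::field" where
  "sign_value Neg = -1"
| "sign_value Zero = 0"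
| "sign_value Pos = 1"

lemma two_neq_0_if_CHAR_neq_2:
  assumes "CHAR('k::field) \<noteq> 2"
  shows "(2::'k) \<noteq> 0"
proof
  assume "(2::'k) = 0"
  then have "of_nat 2 = (0::'k)" by simp
  then have "CHAR('k) dvd 2" by (simp only: of_nat_eq_0_iff_char_dvd)
  then have "CHAR('k) \<le> 2" by (rule dvd_imp_le) simp
  moreover have "CHAR('k) \<noteq> 0" using \<open>CHAR('k) dvd 2\<close> by (metis dvd_0_left_iff zero_neq_numeral)
  moreover have "CHAR('k) \<noteq> 1" using of_nat_CHAR[where 'a='k] by (metis of_nat_1 zero_neq_one)
  ultimately show False using assms by linarith
qed

lemma sign_value_mult: "sign_value (s * t) = sign_value s * sign_value t"
  by (cases s; cases t) simp_all

lemma sign_value_square: "s \<noteq> 0 \<Longrightarrow> (sign_value s)\<^sup>2 = 1"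
  by (cases s) (simp_all add: zero_sign_def)

lemma sign_mult_eq_0_iff: "s * t = 0 \<longleftrightarrow> s = 0 \<or> t = 0" for s t :: sign
  by (cases s; cases t) (simp_all add: zero_sign_def)

text \<open>The units meant are the square roots of 1; a field has no zero divisors, so they are 1
  and -1.\<close>

lemma sign_value_surj_on_units:
  assumes "(x::'k::field)\<^sup>2 = 1"
  shows "\<exists>s. s \<noteq> 0 \<and> sign_value s = x"
proof -
  have "x = 1 \<or> x = -1" using assms by (simp add: power2_eq_1_iff)
  then show ?thesis
    by (metis sign.distinct(2,6) sign_value.simps(1,3) zero_sign_def)
qed

text \<open>Nonzero signs are positive or negative, so one of the two kinds always occurs; the
  equivalence on the left therefore says that both do. Equal signs give the sum 2 or -2, which is
  where 2 being nonzero enters.\<close>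

lemma both_signs_pair_iff:
  assumes "(2::'k::field) \<noteq> 0" "s \<noteq> 0" "t \<noteq> (0::sign)"
  shows "(s > 0 \<or> t > 0 \<longleftrightarrow> s < 0 \<or> t < 0) \<longleftrightarrow> sign_value s + sign_value t = (0::'k)"
  using assms by (cases s; cases t) (auto simp: zero_sign_def add_eq_0_iff)

lemma both_signs_triple_iff:
  assumes "(2::'k::field) \<noteq> 0" "s \<noteq> 0" "t \<noteq> 0" "u \<noteq> (0::sign)"
  shows "(s > 0 \<or> t > 0 \<or> u > 0 \<longleftrightarrow> s < 0 \<or> t < 0 \<or> u < 0) \<longleftrightarrow>
    sign_value s * sign_value t + sign_value t * sign_value u + sign_value u * sign_value s + 1
      = (0::'k)"
proof -
  \<comment> \<open>Three equal signs turn the left side of the equation into 4, which must not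
    vanish.\<close>
  have "(4::'k) = 2 * 2" by simp
  with assms(1) have "(4::'k) \<noteq> 0" by (metis mult_eq_0_iff)
  with assms show ?thesis by (cases s; cases t; cases u) (simp_all add: zero_sign_def)
qed

text \<open>Both directions of the theorem reduce to this. The maps \<open>a\<close>,
  \<open>b\<close> are tied to the signs only at incident pairs, so it applies whether they are
  built from the signs or the signs are chosen from them.\<close>

lemma solves_orientation_system_iff:
  fixes a b :: "'e \<Rightarrow> 'e set \<Rightarrow> 'k::field"
  assumes two: "(2::'k) \<noteq> 0"
    and \<phi>: "\<And>X e. X \<in> circuits E indep \<Longrightarrow> e \<in> X \<Longrightarrow> \<phi> e X \<noteq> 0 \<and> a e X = sign_value (\<phi> e X)"
    and \<phi>': "\<And>Y e. Y \<in> cocircuits E indep \<Longrightarrow> e \<in> Y \<Longrightarrow> \<phi>' e Y \<noteq> 0 \<and> b e Y = sign_value (\<phi>' e Y)"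
  shows "solves_orientation_system E indep a b \<longleftrightarrow>
    (\<forall>X\<in>circuits E indep. \<forall>Y\<in>cocircuits E indep. card (X \<inter> Y) \<in> {2, 3} \<longrightarrow>
       ((\<exists>e\<in>X \<inter> Y. \<phi> e X * \<phi>' e Y > 0) \<longleftrightarrow> (\<exists>f\<in>X \<inter> Y. \<phi> f X * \<phi>' f Y < 0)))"
proof -
  define balanced where "balanced X Y \<longleftrightarrow>
    ((\<exists>e\<in>X \<inter> Y. \<phi> e X * \<phi>' e Y > 0) \<longleftrightarrow> (\<exists>f\<in>X \<inter> Y. \<phi> f X * \<phi>' f Y < 0))" for X Y
  have prod: "\<phi> e X * \<phi>' e Y \<noteq> 0" "a e X * b e Y = sign_value (\<phi> e X * \<phi>' e Y)"
    if "X \<in> circuits E indep" "Y \<in> cocircuits E indep" "e \<in> X \<inter> Y" for X Y e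
    using \<phi>[of X e] \<phi>'[of Y e] that by (auto simp: sign_mult_eq_0_iff sign_value_mult)
  have pair: "a e X * b e Y + a f X * b f Y = 0 \<longleftrightarrow> balanced X Y"
    if XY: "X \<in> circuits E indep" "Y \<in> cocircuits E indep" and eq: "X \<inter> Y = {e, f}" for X Y e f
  proof -
    have "e \<in> X \<inter> Y" "f \<in> X \<inter> Y" using eq by auto
    then show ?thesis
      using both_signs_pair_iff[OF two, of "\<phi> e X * \<phi>' e Y" "\<phi> f X * \<phi>' f Y"] prod[OF XY]
      by (simp add: balanced_def eq)
  qed
  have triple: "a e X * b e Y * a f X * b f Y + a f X * b f Y * a g X * b g Y
            + a g X * b g Y * a e X * b e Y + 1 = 0 \<longleftrightarrow> balanced X Y"
    if XY: "X \<in> circuits E indep" "Y \<in> cocircuits E indep" and eq: "X \<inter> Y = {e, f, g}"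
    for X Y e f g
  proof -
    have mem: "e \<in> X \<inter> Y" "f \<in> X \<inter> Y" "g \<in> X \<inter> Y" using eq by auto
    \<comment> \<open>Regrouping exposes the factors \<open>a e X * b e Y\<close> that
      \<open>prod\<close> rewrites.\<close>
    have assoc: "x * y * z * w = (x * y) * (z * w)" for x y z w :: 'k
      by (simp add: mult.assoc)
    show ?thesis
      unfolding assoc
      unfolding prod(2)[OF XY mem(1)] prod(2)[OF XY mem(2)] prod(2)[OF XY mem(3)]
      using both_signs_triple_iff[OF two prod(1)[OF XY mem(1)] prod(1)[OF XY mem(2)]
          prod(1)[OF XY mem(3)]]
      by (simp add: balanced_def eq)
  qed
  have squares: "\<forall>X\<in>circuits E indep. \<forall>e\<in>X. (a e X)\<^sup>2 - 1 = 0"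
    "\<forall>Y\<in>cocircuits E indep. \<forall>e\<in>Y. (b e Y)\<^sup>2 - 1 = 0"
    using \<phi> \<phi>' by (simp_all add: sign_value_square)
  \<comment> \<open>The square equations hold automatically, so only the conditions on intersections
    remain.\<close>
  have "solves_orientation_system E indep a b \<longleftrightarrow>
    (\<forall>X\<in>circuits E indep. \<forall>Y\<in>cocircuits E indep.
       (\<forall>e f. e \<noteq> f \<and> X \<inter> Y = {e, f} \<longrightarrow> balanced X Y) \<and>
       (\<forall>e f g. e \<noteq> f \<and> f \<noteq> g \<and> e \<noteq> g \<and> X \<inter> Y = {e, f, g} \<longrightarrow> balanced X Y))"
  proof -
    have "(e \<noteq> f \<and> X \<inter> Y = {e, f} \<longrightarrow> a e X * b e Y + a f X * b f Y = 0) \<longleftrightarrow>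
        (e \<noteq> f \<and> X \<inter> Y = {e, f} \<longrightarrow> balanced X Y)"
      if "X \<in> circuits E indep" "Y \<in> cocircuits E indep" for X Y e f
      using pair[OF that] by blast
    moreover have "(e \<noteq> f \<and> f \<noteq> g \<and> e \<noteq> g \<and> X \<inter> Y = {e, f, g} \<longrightarrow>
          a e X * b e Y * a f X * b f Y + a f X * b f Y * a g X * b g Y
            + a g X * b g Y * a e X * b e Y + 1 = 0) \<longleftrightarrow>
        (e \<noteq> f \<and> f \<noteq> g \<and> e \<noteq> g \<and> X \<inter> Y = {e, f, g} \<longrightarrow> balanced X Y)"
      if "X \<in> circuits E indep" "Y \<in> cocircuits E indep" for X Y e f g
      using triple[OF that] by blast
    ultimately show ?thesis
      unfolding solves_orientation_system_def using squares
      by (simp only: ball_conj_distrib ball_triv simp_thms cong: ball_cong)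
  qed
  also have "\<dots> \<longleftrightarrow> (\<forall>X\<in>circuits E indep. \<forall>Y\<in>cocircuits E indep.
       card (X \<inter> Y) \<in> {2, 3} \<longrightarrow> balanced X Y)"
  proof (intro ball_cong refl)
    fix X Y :: "'e set"
    \<comment> \<open>\<open>balanced X Y\<close> does not depend on how the intersection is
      enumerated, so only the existence of an enumeration matters.\<close>
    have "card (X \<inter> Y) \<in> {2, 3} \<longleftrightarrow> (\<exists>e f. e \<noteq> f \<and> X \<inter> Y = {e, f}) \<or>
        (\<exists>e f g. e \<noteq> f \<and> f \<noteq> g \<and> e \<noteq> g \<and> X \<inter> Y = {e, f, g})"
      by (simp add: card_2_iff card_3_iff conj_ac)
    then show "(\<forall>e f. e \<noteq> f \<and> X \<inter> Y = {e, f} \<longrightarrow> balanced X Y) \<and>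
        (\<forall>e f g. e \<noteq> f \<and> f \<noteq> g \<and> e \<noteq> g \<and> X \<inter> Y = {e, f, g} \<longrightarrow> balanced X Y) \<longleftrightarrow>
        (card (X \<inter> Y) \<in> {2, 3} \<longrightarrow> balanced X Y)"
      by presburger
  qed
  finally show ?thesis unfolding balanced_def .
qed

theorem theorem3p3:
  fixes E :: "'e set" and indep :: "'e set \<Rightarrow> bool"
  assumes "matroid E indep"
    and "CHAR('k::field) \<noteq> 2"
  shows "orientable E indep \<longleftrightarrow>
    (\<exists>(a :: 'e \<Rightarrow> 'e set \<Rightarrow> 'k) (b :: 'e \<Rightarrow> 'e set \<Rightarrow> 'k). solves_orientation_system E indep a b)"
proof
  note two = two_neq_0_if_CHAR_neq_2[OF assms(2)]
  \<comment> \<open>\<open>sigma_mapping\<close> speaks only of elements of \<open>E\<close>. The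
    predicate \<open>i\<close> is arbitrary so that the fact also covers cocircuits, the circuits of
    \<open>dual_indep E indep\<close>.\<close>
  have sub: "e \<in> E" if "X \<in> circuits E i" "e \<in> X" for X e and i :: "'e set \<Rightarrow> bool"
    using that by (auto simp: circuits_def)
  {
    assume "orientable E indep"
    then obtain \<phi> \<phi>' where sm: "sigma_mapping E indep \<phi> \<phi>'"
      and balanced: "\<forall>X\<in>circuits E indep. \<forall>Y\<in>cocircuits E indep. card (X \<inter> Y) \<in> {2, 3} \<longrightarrow>
        ((\<exists>e\<in>X \<inter> Y. \<phi> e X * \<phi>' e Y > 0) \<longleftrightarrow> (\<exists>f\<in>X \<inter> Y. \<phi> f X * \<phi>' f Y < 0))"
      unfolding orientable_def by blast
    have "\<phi> e X \<noteq> 0" if "X \<in> circuits E indep" "e \<in> X" for X e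
      using sm sub that unfolding sigma_mapping_def by blast
    moreover have "\<phi>' e Y \<noteq> 0" if "Y \<in> cocircuits E indep" "e \<in> Y" for Y e
      using sm sub that unfolding sigma_mapping_def cocircuits_def by blast
    ultimately have "solves_orientation_system E indep
        (\<lambda>e X. sign_value (\<phi> e X) :: 'k) (\<lambda>e Y. sign_value (\<phi>' e Y))"
      using solves_orientation_system_iff[OF two, of E indep \<phi> _ \<phi>'] balanced by simp
    then show "\<exists>(a :: 'e \<Rightarrow> 'e set \<Rightarrow> 'k) b. solves_orientation_system E indep a b" by blast
  next
    assume "\<exists>(a :: 'e \<Rightarrow> 'e set \<Rightarrow> 'k) b. solves_orientation_system E indep a b"
    then obtain a b :: "'e \<Rightarrow> 'e set \<Rightarrow> 'k" where sol: "solves_orientation_system E indep a b"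
      by blast
    \<comment> \<open>A right inverse of \<open>sign_value\<close> on the square roots of 1.\<close>
    define sgn_of where "sgn_of x = (SOME s. s \<noteq> 0 \<and> sign_value s = x)" for x :: 'k
    have sgn_of: "sgn_of x \<noteq> 0 \<and> x = sign_value (sgn_of x)" if "x\<^sup>2 = 1" for x
      using someI_ex[OF sign_value_surj_on_units[OF that]] unfolding sgn_of_def by simp
    \<comment> \<open>The system does not constrain \<open>a e X\<close> for \<open>e\<close>
      outside \<open>X\<close>; the value 0 there is what \<open>sigma_mapping\<close>
      demands.\<close>
    define \<phi> where "\<phi> e X = (if e \<in> X then sgn_of (a e X) else 0)" for e X
    define \<phi>' where "\<phi>' e Y = (if e \<in> Y then sgn_of (b e Y) else 0)" for e Y
    have \<phi>: "\<phi> e X \<noteq> 0 \<and> a e X = sign_value (\<phi> e X)" if "X \<in> circuits E indep" "e \<in> X" for X e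
      using sol sgn_of that by (simp add: solves_orientation_system_def \<phi>_def)
    have \<phi>': "\<phi>' e Y \<noteq> 0 \<and> b e Y = sign_value (\<phi>' e Y)" if "Y \<in> cocircuits E indep" "e \<in> Y" for Y e
      using sol sgn_of that by (simp add: solves_orientation_system_def \<phi>'_def)
    have "\<phi> e X = 0" "\<phi>' e X = 0" if "e \<notin> X" for e X
      using that by (simp_all add: \<phi>_def \<phi>'_def)
    then have "sigma_mapping E indep \<phi> \<phi>'"
      unfolding sigma_mapping_def using \<phi> \<phi>' by metis
    moreover have "\<forall>X\<in>circuits E indep. \<forall>Y\<in>cocircuits E indep. card (X \<inter> Y) \<in> {2, 3} \<longrightarrow>
        ((\<exists>e\<in>X \<inter> Y. \<phi> e X * \<phi>' e Y > 0) \<longleftrightarrow> (\<exists>f\<in>X \<inter> Y. \<phi> f X * \<phi>' f Y < 0))"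
      by (rule iffD1[OF solves_orientation_system_iff sol]) (fact two, fact \<phi>, fact \<phi>')
    ultimately show "orientable E indep"
      unfolding orientable_def by blast
  }
qed

end
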